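(* Let $a,b,c,p,\theta,z\in\mathbb{C}$ with $-c\notin\mathbb{N}\cup\{0\}$. Then $$\mathcal{G}(z)=(1-\theta z)^{p}F(a,b;c;z)=\sum_{n=0}^{\infty}v_{n}z^{n},$$ with $|z|<1$, $|\arg(1-\theta z)|<\pi$, where $v_{0}=1$, $v_{1}=\frac{ab}{c}-p\theta$, $$v_{2}=\frac{1}{2}\theta^{2}p(p-1)-\theta p\frac{ab}{c}+\frac{1}{2}\frac{ab(b+1)(a+1)}{c(c+1)},$$ and for $n\geq 2$, $$v_{n+1}=\frac{\mu_n}{(n+1)(n+c)}v_{n}-\theta\frac{\zeta_n}{(n+1)(n+c)}v_{n-1}+\theta^{2}\frac{\sigma_n}{(n+1)(n+c)}v_{n-2},$$ with \begin{align*} \mu_n &=(n+a)(n+b)+\theta\left[2n^{2}-2n(p-c+1)-cp\right],\\ \zeta_n &=2n^{2}+2(a+b-p-2)n-(a+b-1)p+2(a-1)(b-1)+\theta(n-p-1)(n-p+c-2),\\ \sigma_n &=(n+a-p-2)(n+b-p-2). \end{align*}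
   Context: The Gauss hypergeometric function is $F(a,b;c;z)=\sum_{n=0}^\infty \frac{(a)_n(b)_n}{(c)_n}\frac{z^n}{n!}$ for $|z|<1$, where $(a)_0=1$ and $(a)_n=a(a+1)\cdots(a+n-1)$ for $n\ge1$. The power $(1-\theta z)^p$ is the principal branch.
   Formalization: For |θ|>1 the series can diverge (a=0, p=-1, θ=2, z=-0.9), so the equality is asserted at every z of the region where Σ v_n z^n converges; convergence is asserted if |θz|<1 or p is a nonnegative integer; 1-θz≠0 is made explicit. *)

theory Defs
  imports "HOL-Analysis.Analysis"
begin

definition gauss_F :: "complex \<Rightarrow> complex \<Rightarrow> complex \<Rightarrow> complex \<Rightarrow> complex" where
  "gauss_F a b c z = (\<Sum>n. pochhammer a n * pochhammer b n / pochhammer c n * (z ^ n / fact n))"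

definition calG :: "complex \<Rightarrow> complex \<Rightarrow> complex \<Rightarrow> complex \<Rightarrow> complex \<Rightarrow> complex \<Rightarrow> complex" where
  "calG a b c p \<theta> z = (1 - \<theta> * z) powr p * gauss_F a b c z"

definition mu_coef :: "complex \<Rightarrow> complex \<Rightarrow> complex \<Rightarrow> complex \<Rightarrow> complex \<Rightarrow> nat \<Rightarrow> complex" where
  "mu_coef a b c p \<theta> n =
     (of_nat n + a) * (of_nat n + b)
     + \<theta> * (2 * of_nat n ^ 2 - 2 * of_nat n * (p - c + 1) - c * p)"

definition zeta_coef :: "complex \<Rightarrow> complex \<Rightarrow> complex \<Rightarrow> complex \<Rightarrow> complex \<Rightarrow> nat \<Rightarrow> complex" where
  "zeta_coef a b c p \<theta> n =
     2 * of_nat n ^ 2 + 2 * (a + b - p - 2) * of_nat n - (a + b - 1) * p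
     + 2 * (a - 1) * (b - 1)
     + \<theta> * (of_nat n - p - 1) * (of_nat n - p + c - 2)"

definition sigma_coef :: "complex \<Rightarrow> complex \<Rightarrow> complex \<Rightarrow> nat \<Rightarrow> complex" where
  "sigma_coef a b p n = (of_nat n + a - p - 2) * (of_nat n + b - p - 2)"

text \<open>In the last equation \<open>n = m + 2\<close> is the index of the recurrence
  expressing \<open>v\<^sub>n\<^sub>+\<^sub>1\<close> through \<open>v\<^sub>n\<close>, \<open>v\<^sub>n\<^sub>-\<^sub>1\<close>, \<open>v\<^sub>n\<^sub>-\<^sub>2\<close>, so \<open>n\<close> runs over all \<open>n \<ge> 2\<close>.\<close>

fun vcoef :: "complex \<Rightarrow> complex \<Rightarrow> complex \<Rightarrow> complex \<Rightarrow> complex \<Rightarrow> nat \<Rightarrow> complex" where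
  "vcoef a b c p \<theta> 0 = 1"
| "vcoef a b c p \<theta> (Suc 0) = a * b / c - p * \<theta>"
| "vcoef a b c p \<theta> (Suc (Suc 0)) =
     1 / 2 * \<theta> ^ 2 * p * (p - 1) - \<theta> * p * (a * b / c)
     + 1 / 2 * (a * b * (b + 1) * (a + 1) / (c * (c + 1)))"
| "vcoef a b c p \<theta> (Suc (Suc (Suc m))) =
     (let n = m + 2; d = (of_nat n + 1) * (of_nat n + c) in
        mu_coef a b c p \<theta> n / d * vcoef a b c p \<theta> (Suc (Suc m))
        - \<theta> * (zeta_coef a b c p \<theta> n / d) * vcoef a b c p \<theta> (Suc m)
        + \<theta> ^ 2 * (sigma_coef a b p n / d) * vcoef a b c p \<theta> m)"

end

theory Submission
  imports Defs "HOL-Complex_Analysis.Complex_Analysis"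
begin

text \<open>
  Multiply formal power series first. The binomial series \<open>U\<close> of \<open>(1 - \<theta> z)\<^sup>p\<close> satisfies
  \<open>(1 - \<theta> X) U' = - p \<theta> U\<close>, and the hypergeometric series \<open>H\<close> satisfies Gauss's second-order
  equation. Substituting \<open>H = V / U\<close> into Gauss's equation and clearing the factor
  \<open>(1 - \<theta> X)\<^sup>2\<close> gives a linear equation for \<open>V = U H\<close> with polynomial coefficients
  (\<open>conjugated_hyp_op\<close>). Its coefficient of \<open>X\<^sup>n\<close> is the four-term recurrence, so the numbers
  \<open>v\<^sub>n\<close> are the coefficients of \<open>V\<close> (\<open>calG_fps_nth\<close>). The radius of convergence of \<open>V\<close> is at
  least the smaller of those of \<open>U\<close> and \<open>H\<close>, which yields summability when \<open>\<bar>\<theta> z\<bar> < 1\<close>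
  or when \<open>p\<close> is a natural number, \<open>U\<close> being a polynomial in the latter case.

  The value of the sum needs an argument of its own, because the series may converge at a
  point \<open>z\<close> with \<open>\<bar>\<theta> z\<bar> \<ge> 1\<close>, where the binomial series itself may diverge. Convergence at
  \<open>z\<close> makes \<open>V\<close> holomorphic on \<open>\<bar>w\<bar> < \<bar>z\<bar>\<close>. There the function \<open>\<G>\<close> is holomorphic off the slit
  where \<open>1 - \<theta> w\<close> is real and nonpositive, the complement of the slit in the disc is starlike
  about \<open>0\<close>, and both functions agree near \<open>0\<close>, so they agree on the slit disc by the identity
  theorem (\<open>calG_eq_eval_on_slit_disc\<close>). The hypotheses on \<open>1 - \<theta> z\<close> put the whole segment
  \<open>[0, z)\<close> into this slit disc. Letting \<open>w = t z\<close> with \<open>t \<rightarrow> 1\<close> from below, \<open>\<G>\<close> tends to its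
  value at \<open>z\<close> by continuity, and the series tends to its sum at \<open>z\<close> by Abel's limit theorem
  (\<open>Abel_radial_limit\<close>).
\<close>

(* Both vectors and formal power series write coefficients with the same infix symbol. *)
unbundle no vec_syntax

section \<open>The two factors as formal power series\<close>

definition binom_fps :: "'a::field_char_0 \<Rightarrow> 'a \<Rightarrow> 'a fps" where
  "binom_fps p \<theta> = Abs_fps (\<lambda>n. (p gchoose n) * (- \<theta>) ^ n)"

definition hyp_fps :: "'a::field_char_0 \<Rightarrow> 'a \<Rightarrow> 'a \<Rightarrow> 'a fps" where
  "hyp_fps a b c = Abs_fps (\<lambda>n. pochhammer a n * pochhammer b n / pochhammer c n / fact n)"

lemma linear_fps_mult_nth_Suc:
  fixes f :: "'a::comm_ring_1 fps"
  shows "((1 - fps_const \<theta> * fps_X) * f) $ Suc n = f $ Suc n - \<theta> * f $ n"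
  by (simp add: algebra_simps)

lemma linear_fps_mult_nth_0:
  fixes f :: "'a::comm_ring_1 fps"
  shows "((1 - fps_const \<theta> * fps_X) * f) $ 0 = f $ 0"
  by (simp add: algebra_simps)

text \<open>
  The formal counterpart of differentiating \<open>(1 - \<theta> z)\<^sup>p\<close>. On coefficients it is the ratio
  \<open>(k + 1) (p gchoose (k + 1)) = (p - k) (p gchoose k)\<close>.
\<close>

lemma binom_fps_ode:
  "(1 - fps_const \<theta> * fps_X) * fps_deriv (binom_fps p \<theta>) = - fps_const (p * \<theta>) * binom_fps p \<theta>"
proof (rule fps_ext)
  fix n
  have absorb: "of_nat (Suc n) * (p gchoose Suc n) = (p - of_nat n) * (p gchoose n)" for n
    by (simp only: gbinomial_absorption gbinomial_absorb_comp)
  show "((1 - fps_const \<theta> * fps_X) * fps_deriv (binom_fps p \<theta>)) $ n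
          = (- fps_const (p * \<theta>) * binom_fps p \<theta>) $ n"
  proof (cases n)
    case 0
    then show ?thesis by (simp add: linear_fps_mult_nth_0 binom_fps_def)
  next
    case (Suc k)
    have "((1 - fps_const \<theta> * fps_X) * fps_deriv (binom_fps p \<theta>)) $ n
        = (of_nat (Suc n) * (p gchoose Suc n)) * (- \<theta>) ^ Suc n
          - \<theta> * (of_nat n * (p gchoose n) * (- \<theta>) ^ n)"
      by (simp only: Suc linear_fps_mult_nth_Suc) (simp add: binom_fps_def algebra_simps)
    also have "\<dots> = - (p * \<theta>) * ((p gchoose n) * (- \<theta>) ^ n)"
      by (simp only: absorb) (simp add: algebra_simps)
    finally show ?thesis
      by (simp add: binom_fps_def fps_mult_left_const_nth flip: fps_const_neg)
  qed
qed

lemma hyp_fps_nth_Suc: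
  assumes "- c \<notin> \<nat>"
  shows "(of_nat n + 1) * (of_nat n + c) * hyp_fps a b c $ Suc n
           = (of_nat n + a) * (of_nat n + b) * hyp_fps a b c $ n"
proof -
  have nz: "c + of_nat k \<noteq> 0" for k
    using assms by (metis add_eq_0_iff2 minus_minus of_nat_in_Nats)
  have nz1: "1 + of_nat n \<noteq> (0 :: 'a)"
    by (metis of_nat_Suc of_nat_neq_0)
  have "hyp_fps a b c $ Suc n
          = hyp_fps a b c $ n * ((a + of_nat n) * (b + of_nat n) / ((c + of_nat n) * (1 + of_nat n)))"
    by (simp add: hyp_fps_def pochhammer_Suc mult_ac)
  thus ?thesis
    using nz[of n] nz1 by (simp add: add_ac mult_ac)
qed

text \<open>
  Gauss's hypergeometric differential operator
  \<open>X (1 - X) f'' + (c - (a + b + 1) X) f' - a b f\<close>, expanded so that every derivative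
  carries its own power of \<open>X\<close>; the coefficient formula \<open>hyp_op_nth\<close> then holds at every
  index, with no exception for small \<open>n\<close>.
\<close>

definition hyp_op :: "'a::field_char_0 \<Rightarrow> 'a \<Rightarrow> 'a \<Rightarrow> 'a fps \<Rightarrow> 'a fps" where
  "hyp_op a b c f = fps_X * fps_deriv (fps_deriv f) - fps_X ^ 2 * fps_deriv (fps_deriv f)
     + fps_const c * fps_deriv f - fps_const (a + b + 1) * (fps_X * fps_deriv f)
     - fps_const (a * b) * f"

lemma fps_X_mult_deriv_nth: "(fps_X * fps_deriv f) $ n = of_nat n * f $ n"
  by (cases n) simp_all

text \<open>
  The operator acts on coefficients with two terms only, and these are exactly the ones
  compared in the ratio of consecutive hypergeometric coefficients.
\<close>

lemma hyp_op_nth: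
  "hyp_op a b c f $ n = (of_nat n + 1) * (of_nat n + c) * f $ Suc n
      - (of_nat n + a) * (of_nat n + b) * f $ n"
proof -
  have 1: "(fps_X * fps_deriv (fps_deriv f)) $ n = of_nat n * (of_nat n + 1) * f $ Suc n"
    by (cases n) (simp_all add: algebra_simps)
  have 2: "(fps_X ^ 2 * fps_deriv (fps_deriv f)) $ n = of_nat n * (of_nat n - 1) * f $ n"
  proof (cases n)
    case (Suc k)
    then show ?thesis
      by (cases k) (simp_all add: power2_eq_square mult.assoc algebra_simps)
  qed (simp add: power2_eq_square)
  show ?thesis
    unfolding hyp_op_def fps_sub_nth fps_add_nth fps_mult_left_const_nth fps_X_mult_deriv_nth 1 2
    by (simp add: algebra_simps)
qed

lemma hyp_op_hyp_fps:
  assumes "- c \<notin> \<nat>"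
  shows "hyp_op a b c (hyp_fps a b c) = 0"
  by (rule fps_ext) (simp add: hyp_op_nth hyp_fps_nth_Suc[OF assms])

section \<open>The recurrence\<close>

text \<open>
  Multiplication by \<open>U\<close> conjugates the hypergeometric operator. Writing \<open>L = 1 - \<theta> X\<close>, the
  equation for \<open>U\<close> gives \<open>L U H' = L V' + p \<theta> V\<close> and
  \<open>L\<^sup>2 U H'' = L\<^sup>2 V'' + 2 p \<theta> L V' + p (p + 1) \<theta>\<^sup>2 V\<close>, so \<open>L\<^sup>2 U\<close> times the equation for \<open>H\<close>
  becomes an equation for \<open>V\<close>. It is arranged by powers of \<open>L\<close>, and \<open>X\<close> is kept next to
  the derivatives, so that the coefficient of \<open>X\<^sup>n\<close> can be read off term by term.
\<close>

lemma conjugated_hyp_op: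
  fixes U H :: "'a::field_char_0 fps"
  assumes U: "(1 - fps_const \<theta> * fps_X) * fps_deriv U = - fps_const (p * \<theta>) * U"
    and H: "hyp_op a b c H = 0"
  defines "L \<equiv> 1 - fps_const \<theta> * fps_X" and "V \<equiv> U * H"
  shows "L * (L * hyp_op a b c V)
    + fps_const (p * \<theta>) * (L * (fps_const 2 * (fps_X * fps_deriv V - fps_X * (fps_X * fps_deriv V))
          + fps_const c * V - fps_const (a + b + 1) * (fps_X * V)))
    + fps_const (p * (p + 1) * \<theta>\<^sup>2) * (fps_X * V - fps_X * (fps_X * V)) = 0"
proof -
  define t P where "t = fps_const \<theta>" and "P = fps_const p"
  define A B C where "A = fps_const a" and "B = fps_const b" and "C = fps_const c"
  define X where "X = (fps_X :: 'a fps)"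
  define U1 U2 H1 H2 where "U1 = fps_deriv U" and "U2 = fps_deriv U1"
    and "H1 = fps_deriv H" and "H2 = fps_deriv H1"
  have Ldef: "L = 1 - t * X"
    by (simp add: L_def t_def X_def)
  have const_eqs: "fps_const (p * \<theta>) = P * t" "fps_const (p * (p + 1) * \<theta>\<^sup>2) = P * (P + 1) * t\<^sup>2"
      "fps_const (a + b + 1) = A + B + 1" "fps_const (a * b) = A * B" "fps_const (2::'a) = 2"
    by (simp_all add: P_def t_def A_def B_def power2_eq_square fps_numeral_fps_const
          flip: fps_const_mult fps_const_add)
  have U1: "L * U1 = - (P * t) * U"
    using U by (simp add: L_def U1_def const_eqs)
  have deriv_const: "fps_deriv t = 0" "fps_deriv P = 0" "fps_deriv L = - t"
    by (simp_all add: t_def P_def L_def)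
  have "fps_deriv (L * U1) = fps_deriv (- (P * t) * U)"
    by (simp only: U1)
  hence "L * U2 - t * U1 = - (P * t) * U1"
    by (simp add: deriv_const U2_def U1_def)
  hence U2: "L * U2 = t * (1 - P) * U1"
    by (simp add: algebra_simps)
  have V1: "fps_deriv V = U1 * H + U * H1"
    by (simp add: V_def U1_def H1_def algebra_simps)
  have V2: "fps_deriv (fps_deriv V) = U2 * H + 2 * U1 * H1 + U * H2"
    by (simp add: V1 U2_def H2_def algebra_simps) (simp add: U1_def H1_def algebra_simps)
  have H': "X * H2 - X\<^sup>2 * H2 + C * H1 - (A + B + 1) * (X * H1) - A * B * H = 0"
    using H by (simp add: hyp_op_def const_eqs X_def H1_def H2_def C_def)
  \<comment> \<open>The left-hand side is \<open>L\<^sup>2 U\<close> times the equation for \<open>H\<close>.\<close>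
  have "L * (L * (X * (U2 * H + 2 * U1 * H1 + U * H2) - X\<^sup>2 * (U2 * H + 2 * U1 * H1 + U * H2)
        + C * (U1 * H + U * H1) - (A + B + 1) * (X * (U1 * H + U * H1)) - A * B * (U * H)))
      + P * t * (L * (2 * (X * (U1 * H + U * H1) - X * (X * (U1 * H + U * H1)))
          + C * (U * H) - (A + B + 1) * (X * (U * H))))
      + P * (P + 1) * t\<^sup>2 * (X * (U * H) - X * (X * (U * H))) = 0"
    using U1 U2 H' by algebra
  thus ?thesis
    unfolding hyp_op_def V2 unfolding V1 const_eqs X_def C_def unfolding V_def .
qed


lemma fps_X_mult_nth_Suc_eq: "(fps_X * (f :: 'a::comm_ring_1 fps)) $ Suc n = f $ n"
  by simp

text \<open>
  This is the coefficient of \<open>X\<^sup>n\<close> in the conjugated equation. Each factor \<open>1 - \<theta> X\<close> lowers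
  the index by one, which explains the three indices below \<open>n + 1\<close>, and \<open>n \<ge> 2\<close> guarantees
  that no boundary term appears.
\<close>

lemma conjugated_hyp_coeff_recurrence:
  fixes U H :: "complex fps"
  assumes "(1 - fps_const \<theta> * fps_X) * fps_deriv U = - fps_const (p * \<theta>) * U"
    and "hyp_op a b c H = 0"
  defines "v \<equiv> fps_nth (U * H)"
  assumes "n = m + 2"
  shows "(of_nat n + 1) * (of_nat n + c) * v (Suc n)
           = mu_coef a b c p \<theta> n * v n - \<theta> * zeta_coef a b c p \<theta> n * v (Suc m)
             + \<theta>\<^sup>2 * sigma_coef a b p n * v m"
proof -
  have "0 = (0 :: complex fps) $ Suc (Suc m)" by simp
  also have "\<dots> = (of_nat m + 3) * (of_nat m + 2 + c) * v (Suc (Suc (Suc m)))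
      - (of_nat m + 2 + a) * (of_nat m + 2 + b) * v (Suc (Suc m))
      - 2 * \<theta> * ((of_nat m + 2) * (of_nat m + 1 + c) * v (Suc (Suc m))
          - (of_nat m + 1 + a) * (of_nat m + 1 + b) * v (Suc m))
      + \<theta>\<^sup>2 * ((of_nat m + 1) * (of_nat m + c) * v (Suc m)
          - (of_nat m + a) * (of_nat m + b) * v m)
      + p * \<theta> * (2 * ((of_nat m + 2) * v (Suc (Suc m)) - (of_nat m + 1) * v (Suc m))
          + c * v (Suc (Suc m)) - (a + b + 1) * v (Suc m))
      - p * \<theta>\<^sup>2 * (2 * ((of_nat m + 1) * v (Suc m) - of_nat m * v m)
          + c * v (Suc m) - (a + b + 1) * v m)
      + p * (p + 1) * \<theta>\<^sup>2 * (v (Suc m) - v m)"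
    unfolding conjugated_hyp_op[OF assms(1,2), symmetric] v_def
    unfolding fps_add_nth fps_sub_nth fps_mult_left_const_nth linear_fps_mult_nth_Suc
      fps_X_mult_nth_Suc_eq fps_X_mult_deriv_nth hyp_op_nth fps_deriv_nth
    by (simp add: algebra_simps power2_eq_square)
  finally show ?thesis
    unfolding mu_coef_def zeta_coef_def sigma_coef_def \<open>n = m + 2\<close>
    by (simp add: algebra_simps power2_eq_square)
qed

definition calG_fps :: "complex \<Rightarrow> complex \<Rightarrow> complex \<Rightarrow> complex \<Rightarrow> complex \<Rightarrow> complex fps" where
  "calG_fps a b c p \<theta> = binom_fps p \<theta> * hyp_fps a b c"

lemma calG_fps_nth:
  assumes "- c \<notin> \<nat>"
  shows "calG_fps a b c p \<theta> $ n = vcoef a b c p \<theta> n"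
  using assms
proof (induction a b c p \<theta> n rule: vcoef.induct)
  case (1 a b c p \<theta>)
  show ?case by (simp add: calG_fps_def binom_fps_def hyp_fps_def)
next
  case (2 a b c p \<theta>)
  show ?case by (simp add: calG_fps_def binom_fps_def hyp_fps_def fps_mult_nth)
next
  case (3 a b c p \<theta>)
  show ?case
    by (simp add: calG_fps_def binom_fps_def hyp_fps_def fps_mult_nth numeral_2_eq_2
          pochhammer_Suc gbinomial_Suc power2_eq_square)
       (simp add: mult_ac)
next
  case (4 a b c p \<theta> m)
  let ?n = "m + 2"
  let ?d = "(of_nat ?n + 1) * (of_nat ?n + c)"
  have "of_nat ?n + c \<noteq> 0"
    using "4.prems" by (metis add_eq_0_iff2 of_nat_in_Nats)
  moreover have "of_nat ?n + (1 :: complex) \<noteq> 0"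
    by (metis of_nat_Suc of_nat_neq_0 add.commute)
  ultimately have d: "?d \<noteq> 0" by simp
  have "?d * calG_fps a b c p \<theta> $ Suc ?n = mu_coef a b c p \<theta> ?n * calG_fps a b c p \<theta> $ ?n
      - \<theta> * zeta_coef a b c p \<theta> ?n * calG_fps a b c p \<theta> $ Suc m
      + \<theta>\<^sup>2 * sigma_coef a b p ?n * calG_fps a b c p \<theta> $ m"
    unfolding calG_fps_def
    by (rule conjugated_hyp_coeff_recurrence[OF binom_fps_ode hyp_op_hyp_fps[OF "4.prems"] refl])
  hence "calG_fps a b c p \<theta> $ Suc ?n = (mu_coef a b c p \<theta> ?n * calG_fps a b c p \<theta> $ ?n
      - \<theta> * zeta_coef a b c p \<theta> ?n * calG_fps a b c p \<theta> $ Suc m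
      + \<theta>\<^sup>2 * sigma_coef a b p ?n * calG_fps a b c p \<theta> $ m) / ?d"
    by (metis d nonzero_mult_div_cancel_left)
  also have "\<dots> = mu_coef a b c p \<theta> ?n / ?d * calG_fps a b c p \<theta> $ ?n
      - \<theta> * (zeta_coef a b c p \<theta> ?n / ?d) * calG_fps a b c p \<theta> $ Suc m
      + \<theta>\<^sup>2 * (sigma_coef a b p ?n / ?d) * calG_fps a b c p \<theta> $ m"
    by (simp add: add_divide_distrib diff_divide_distrib)
  finally show ?case
    using "4.IH" "4.prems" by (simp add: Let_def)
qed

section \<open>Convergence\<close>

text \<open>
  For \<open>\<theta> = 0\<close> and for natural \<open>p\<close> the series is a polynomial and the radius is infinite;
  otherwise it is \<open>1 / \<bar>\<theta>\<bar>\<close>.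
\<close>

lemma binom_fps_conv_radius:
  fixes p :: complex
  assumes "norm (\<theta> * z) < 1 \<or> p \<in> \<nat>"
  shows "norm z < fps_conv_radius (binom_fps p \<theta>)"
proof (cases "\<theta> = 0")
  case True
  hence "\<forall>\<^sub>F n in sequentially. binom_fps p \<theta> $ n = 0"
    by (intro eventually_mono[OF eventually_gt_at_top[of 0]]) (simp add: binom_fps_def)
  from conv_radius_cong'[OF this] show ?thesis by (simp add: fps_conv_radius_def)
next
  case False
  hence "fps_conv_radius (binom_fps p \<theta>) = conv_radius (\<lambda>n. p gchoose n) / norm \<theta>"
    using conv_radius_mult_power_right[of "- \<theta>" "\<lambda>n. p gchoose n"]
    by (simp add: fps_conv_radius_def binom_fps_def)
  moreover have "1 / ereal (norm \<theta>) = ereal (1 / norm \<theta>)"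
    using False by (simp add: one_ereal_def)
  ultimately show ?thesis
    using assms False by (auto simp: conv_radius_gchoose norm_mult field_simps)
qed

lemma eval_binom_fps:
  fixes z :: complex
  assumes "norm (\<theta> * z) < 1"
  shows "eval_fps (binom_fps p \<theta>) z = (1 - \<theta> * z) powr p"
  using gen_binomial_complex[of "- (\<theta> * z)" p] assms
  by (simp add: eval_fps_def binom_fps_def sums_iff power_mult_distrib[symmetric] mult.assoc)

text \<open>
  The ratio of consecutive coefficients tends to \<open>1\<close>. The series terminates when \<open>a\<close> or \<open>b\<close>
  is a nonpositive integer, so only a lower bound holds in general; the ratio test, which
  tolerates vanishing terms, proves it without a case distinction.
\<close>

lemma hyp_fps_conv_radius:
  fixes c :: complex
  assumes "- c \<notin> \<nat>"
  shows "fps_conv_radius (hyp_fps a b c) \<ge> 1"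
  unfolding fps_conv_radius_def
proof (rule conv_radius_geI_ex')
  fix r :: real
  assume r: "0 < r" "ereal r < 1"
  let ?h = "fps_nth (hyp_fps a b c)"
  let ?q = "\<lambda>n. (of_nat n + a) / (of_nat n + c) * ((of_nat n + b) / (of_nat n + 1))"
  have nz: "of_nat n + c \<noteq> 0" for n
    using assms by (metis add_eq_0_iff2 add.commute minus_minus of_nat_in_Nats)
  have nz1: "of_nat n + 1 \<noteq> (0 :: complex)" for n
    by (metis of_nat_Suc of_nat_neq_0 add.commute)
  have lim: "(\<lambda>n. (of_nat n + x) / (of_nat n + y)) \<longlonglongrightarrow> 1"
    if nz: "\<And>n. of_nat n + y \<noteq> 0" for x y :: complex
  proof -
    have "filterlim (\<lambda>n. of_nat n + y) at_infinity sequentially"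
      by (rule tendsto_add_filterlim_at_infinity'[OF tendsto_of_nat tendsto_const])
    hence "(\<lambda>n. 1 + (x - y) / (of_nat n + y)) \<longlonglongrightarrow> 1 + 0"
      by (intro tendsto_add tendsto_divide_0[OF tendsto_const] tendsto_const)
    moreover have "1 + (x - y) / (of_nat n + y) = (of_nat n + x) / (of_nat n + y)" for n
      using nz[of n] by (simp add: field_simps)
    ultimately show ?thesis by simp
  qed
  have "?q \<longlonglongrightarrow> 1 * 1"
    by (intro tendsto_mult lim nz nz1)
  hence "(\<lambda>n. norm (?q n) * r) \<longlonglongrightarrow> norm (1 * 1 :: complex) * r"
    by (intro tendsto_mult[OF tendsto_norm tendsto_const])
  hence "(\<lambda>n. norm (?q n) * r) \<longlonglongrightarrow> r"
    by simp
  moreover have "r < (1 + r) / 2"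
    using r by simp
  ultimately have "\<forall>\<^sub>F n in sequentially. norm (?q n) * r < (1 + r) / 2"
    by (rule order_tendstoD)
  then obtain N where N: "\<And>n. n \<ge> N \<Longrightarrow> norm (?q n) * r < (1 + r) / 2"
    unfolding eventually_sequentially by blast
  show "summable (\<lambda>n. ?h n * of_real r ^ n)"
  proof (rule summable_ratio_test)
    show "(1 + r) / 2 < 1" using r by simp
    fix n assume "n \<ge> N"
    have "?h (Suc n) = ?q n * ?h n"
    proof -
      have "?q n * ?h n = ((of_nat n + a) * (of_nat n + b) * ?h n) / ((of_nat n + 1) * (of_nat n + c))"
        by (simp add: mult_ac)
      also have "\<dots> = ?h (Suc n)"
        unfolding hyp_fps_nth_Suc[OF assms, symmetric] using nz[of n] nz1[of n] by simp
      finally show ?thesis ..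
    qed
    hence "norm (?h (Suc n) * of_real r ^ Suc n) = norm (?q n) * r * norm (?h n * of_real r ^ n)"
      using r by (simp add: norm_mult norm_power norm_divide mult_ac)
    also have "\<dots> \<le> (1 + r) / 2 * norm (?h n * of_real r ^ n)"
      using N[OF \<open>n \<ge> N\<close>] by (intro mult_right_mono) auto
    finally show "norm (?h (Suc n) * of_real r ^ Suc n) \<le> (1 + r) / 2 * norm (?h n * of_real r ^ n)" .
  qed
qed

lemma eval_hyp_fps: "eval_fps (hyp_fps a b c) z = gauss_F a b c z"
  by (simp add: eval_fps_def hyp_fps_def gauss_F_def)

section \<open>Abel's limit theorem\<close>

text \<open>
  The weights \<open>(1 - t) t\<^sup>n\<close> sum to \<open>1\<close>, and each of them vanishes as \<open>t \<rightarrow> 1\<close>. Hence the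
  initial terms are damped by the factor \<open>1 - t\<close>, and the remaining ones are averaged.
\<close>

lemma Abel_null_sequence:
  fixes r :: "nat \<Rightarrow> 'a::banach"
  assumes r: "r \<longlonglongrightarrow> 0"
  shows "((\<lambda>t. (1 - t) *\<^sub>R (\<Sum>n. t ^ n *\<^sub>R r n)) \<longlongrightarrow> 0) (at_left (1 :: real))"
proof (rule tendstoI)
  fix e :: real assume "e > 0"
  then obtain N where N: "\<And>n. n \<ge> N \<Longrightarrow> norm (r n) < e / 2"
    using LIMSEQ_D[OF r, of "e / 2"] by auto
  define K where "K = (\<Sum>n<N. norm (r n))"
  have bound: "norm ((1 - t) *\<^sub>R (\<Sum>n. t ^ n *\<^sub>R r n)) \<le> (1 - t) * K + e / 2" if t: "0 < t" "t < 1" for t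
  proof -
    let ?g = "\<lambda>n. (if n \<in> {..<N} then norm (r n) else 0) + e / 2 * t ^ n"
    have "(\<lambda>n. if n \<in> {..<N} then norm (r n) else 0) sums K"
      unfolding K_def by (rule sums_If_finite_set) simp
    moreover have "(\<lambda>n. e / 2 * t ^ n) sums (e / 2 * (1 / (1 - t)))"
      using t by (intro sums_mult geometric_sums) simp
    ultimately have g: "?g sums (K + e / 2 * (1 / (1 - t)))"
      by (rule sums_add)
    have le: "norm (t ^ n *\<^sub>R r n) \<le> ?g n" for n
    proof (cases "n < N")
      case True
      have "t ^ n * norm (r n) \<le> 1 * norm (r n)"
        using t by (intro mult_right_mono power_le_one) auto
      moreover have "0 \<le> e / 2 * t ^ n" using t \<open>e > 0\<close> by simp
      ultimately show ?thesis using True t by simp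
    next
      case False
      have "t ^ n * norm (r n) \<le> t ^ n * (e / 2)"
        using t N[of n] False by (intro mult_left_mono) auto
      thus ?thesis using False t by (simp add: mult_ac)
    qed
    have "norm (\<Sum>n. t ^ n *\<^sub>R r n) \<le> K + e / 2 * (1 / (1 - t))"
      using norm_suminf_le[OF le sums_summable[OF g]] sums_unique[OF g] by simp
    hence "(1 - t) * norm (\<Sum>n. t ^ n *\<^sub>R r n) \<le> (1 - t) * (K + e / 2 * (1 / (1 - t)))"
      using t by (intro mult_left_mono) auto
    also have "\<dots> = (1 - t) * K + e / 2"
      using t by (simp add: field_simps)
    finally show ?thesis using t by simp
  qed
  have "((\<lambda>t. (1 - t) * K + e / 2) \<longlongrightarrow> (1 - 1) * K + e / 2) (at_left (1::real))"
    by (intro tendsto_intros)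
  hence "\<forall>\<^sub>F t in at_left 1. (1 - t) * K + e / 2 < e"
    using \<open>e > 0\<close> by (intro order_tendstoD(2)[where y = "(1 - 1) * K + e / 2"]) auto
  moreover have "\<forall>\<^sub>F t in at_left (1::real). t \<in> {0<..<1}"
    by (rule eventually_at_leftI[of 0]) auto
  ultimately show "\<forall>\<^sub>F t in at_left 1. dist ((1 - t) *\<^sub>R (\<Sum>n. t ^ n *\<^sub>R r n)) 0 < e"
  proof eventually_elim
    case (elim t)
    thus ?case using bound[of t] by auto
  qed
qed

text \<open>
  Summation by parts reduces this to the previous lemma: if \<open>r\<^sub>n\<close> is the \<open>n\<close>-th partial sum
  minus the total sum \<open>s\<close>, then \<open>a\<^sub>n = r\<^sub>n\<^sub>+\<^sub>1 - r\<^sub>n\<close>, \<open>r\<^sub>0 = - s\<close>, and therefore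
  \<open>t (\<Sum>n. t\<^sup>n a\<^sub>n) = (1 - t) (\<Sum>n. t\<^sup>n r\<^sub>n) + s\<close>.
\<close>

lemma Abel_radial_limit:
  fixes a :: "nat \<Rightarrow> 'a::banach"
  assumes a: "summable a"
  shows "((\<lambda>t. \<Sum>n. t ^ n *\<^sub>R a n) \<longlongrightarrow> suminf a) (at_left (1 :: real))"
proof -
  define r where "r = (\<lambda>n. (\<Sum>k<n. a k) - suminf a)"
  have r: "r \<longlonglongrightarrow> 0"
    unfolding r_def using summable_LIMSEQ[OF a] by (simp add: LIM_zero_iff)
  let ?R = "\<lambda>t. \<Sum>n. t ^ n *\<^sub>R r n"
  have *: "(1 / t) *\<^sub>R ((1 - t) *\<^sub>R ?R t + suminf a) = (\<Sum>n. t ^ n *\<^sub>R a n)"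
    if t: "0 < t" "t < 1" for t :: real
  proof -
    obtain B where B: "\<And>n. norm (r n) \<le> B"
      using convergent_imp_Bseq[OF convergentI[OF r]] unfolding Bseq_def by blast
    have "summable (\<lambda>n. t ^ n *\<^sub>R r n)"
    proof (rule summable_comparison_test')
      show "summable (\<lambda>n. t ^ n * B)"
        using t by (intro summable_mult2 summable_geometric) simp
      show "norm (t ^ n *\<^sub>R r n) \<le> t ^ n * B" for n
        using t B[of n] by (simp add: mult_left_mono)
    qed
    hence sr: "(\<lambda>n. t ^ n *\<^sub>R r n) sums ?R t"
      by (rule summable_sums)
    hence "(\<lambda>n. t ^ Suc n *\<^sub>R r (Suc n)) sums (?R t - t ^ 0 *\<^sub>R r 0)"
      by (subst sums_Suc_iff) simp
    moreover have "(\<lambda>n. t *\<^sub>R (t ^ n *\<^sub>R r n)) sums (t *\<^sub>R ?R t)"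
      using sr by (rule sums_scaleR_right)
    ultimately have "(\<lambda>n. t ^ Suc n *\<^sub>R r (Suc n) - t *\<^sub>R (t ^ n *\<^sub>R r n))
        sums (?R t - t ^ 0 *\<^sub>R r 0 - t *\<^sub>R ?R t)"
      by (rule sums_diff)
    hence "(\<lambda>n. t *\<^sub>R (t ^ n *\<^sub>R a n)) sums ((1 - t) *\<^sub>R ?R t + suminf a)"
      by (simp add: r_def algebra_simps)
    from sums_scaleR_right[OF this, of "1 / t"] show ?thesis
      using t by (simp add: sums_iff)
  qed
  have "((\<lambda>t. (1 / t) *\<^sub>R ((1 - t) *\<^sub>R ?R t + suminf a)) \<longlongrightarrow> (1 / 1) *\<^sub>R (0 + suminf a)) (at_left (1::real))"
    by (intro tendsto_intros Abel_null_sequence[OF r]) simp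
  moreover have "\<forall>\<^sub>F t in at_left 1. (1 / t) *\<^sub>R ((1 - t) *\<^sub>R ?R t + suminf a) = (\<Sum>n. t ^ n *\<^sub>R a n)"
    by (rule eventually_at_leftI[of 0]) (use * in auto)
  ultimately show ?thesis
    by (auto elim: Lim_transform_eventually)
qed

section \<open>The identity up to the given point\<close>

text \<open>
  The number \<open>1 - u w\<close> lies on the segment from \<open>1\<close> to \<open>1 - w\<close>, and the slit plane is starlike
  about \<open>1\<close>.
\<close>

lemma slit_plane_scaleR:
  fixes w :: complex
  assumes w: "1 - w \<notin> \<real>\<^sub>\<le>\<^sub>0" and u: "0 \<le> u" "u \<le> 1"
  shows "1 - of_real u * w \<notin> \<real>\<^sub>\<le>\<^sub>0"
proof
  assume "1 - of_real u * w \<in> \<real>\<^sub>\<le>\<^sub>0"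
  hence re: "1 \<le> u * Re w" and im: "u * Im w = 0"
    by (auto simp: complex_nonpos_Reals_iff)
  have "u \<noteq> 0" using re by auto
  have "1 \<le> Re w"
  proof (rule ccontr)
    assume "\<not> 1 \<le> Re w"
    hence "u * Re w < u * 1" using u \<open>u \<noteq> 0\<close> by (intro mult_strict_left_mono) auto
    thus False using re u by simp
  qed
  with im \<open>u \<noteq> 0\<close> w show False
    by (simp add: complex_nonpos_Reals_iff)
qed

lemma slit_disc_connected:
  fixes \<theta> :: complex
  assumes "r > 0"
  shows "connected {w \<in> ball 0 r. 1 - \<theta> * w \<notin> \<real>\<^sub>\<le>\<^sub>0}"
proof (rule starlike_imp_connected)
  let ?S = "{w \<in> ball 0 r. 1 - \<theta> * w \<notin> \<real>\<^sub>\<le>\<^sub>0}"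
  have "closed_segment 0 w \<subseteq> ?S" if w: "w \<in> ?S" for w
  proof
    fix x assume x: "x \<in> closed_segment 0 w"
    then obtain u :: real where u: "0 \<le> u" "u \<le> 1" "x = of_real u * w"
      by (auto simp: closed_segment_def scaleR_conv_of_real)
    have "x \<in> ball 0 r"
      using x w convex_ball[of 0 r] assms closed_segment_subset[of 0 "ball 0 r" w] by auto
    moreover have "1 - \<theta> * x \<notin> \<real>\<^sub>\<le>\<^sub>0"
      using slit_plane_scaleR[of "\<theta> * w" u] w u by (simp add: mult.left_commute)
    ultimately show "x \<in> ?S" by simp
  qed
  moreover have "0 \<in> ?S" using assms by simp
  ultimately show "starlike ?S"
    unfolding starlike_def by blast
qed

text \<open>
  The product of the two series represents the function where both converge, in
  particular on a small disc about \<open>0\<close>. The identity theorem extends this to the whole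
  slit disc, where the binomial series itself may diverge.
\<close>

lemma calG_eq_eval_on_slit_disc:
  assumes c: "- c \<notin> \<nat>" and r: "0 < r" "r \<le> 1" "r \<le> fps_conv_radius (calG_fps a b c p \<theta>)"
    and w: "norm w < r" "1 - \<theta> * w \<notin> \<real>\<^sub>\<le>\<^sub>0"
  shows "calG a b c p \<theta> w = eval_fps (calG_fps a b c p \<theta>) w"
proof -
  define S where "S = {w \<in> ball 0 r. 1 - \<theta> * w \<notin> \<real>\<^sub>\<le>\<^sub>0}"
  \<comment> \<open>Adding \<open>1\<close> to the norm keeps \<open>\<bar>\<theta> x\<bar> < 1\<close> on this disc and also covers \<open>\<theta> = 0\<close>.\<close>
  define d where "d = min r (1 / (1 + norm \<theta>))"
  have small: "norm (\<theta> * x) < 1" if "x \<in> ball 0 d" for x :: complex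
  proof -
    have "norm \<theta> * norm x \<le> norm \<theta> * (1 / (1 + norm \<theta>))"
      using that by (intro mult_left_mono) (auto simp: d_def)
    also have "\<dots> < 1" by (simp add: field_simps add_pos_nonneg)
    finally show ?thesis by (simp add: norm_mult)
  qed
  have hyp: "norm x < fps_conv_radius (hyp_fps a b c)" if "norm x < r" for x :: complex
  proof -
    have "ereal (norm x) < 1" using that r by simp
    also have "\<dots> \<le> fps_conv_radius (hyp_fps a b c)" by (rule hyp_fps_conv_radius[OF c])
    finally show ?thesis .
  qed
  show ?thesis
  proof (rule analytic_continuation_open[of "ball 0 d" S
        "calG a b c p \<theta>" "eval_fps (calG_fps a b c p \<theta>)"])
    have "(\<lambda>w. 1 - \<theta> * w) -` (- \<real>\<^sub>\<le>\<^sub>0) \<inter> ball 0 r = S"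
      by (auto simp: S_def)
    moreover have "open ((\<lambda>w. 1 - \<theta> * w) -` (- \<real>\<^sub>\<le>\<^sub>0) \<inter> ball 0 r)"
      by (intro open_Int open_vimage continuous_intros) (auto intro: open_Compl)
    ultimately show "open S" by simp
    show "connected S" unfolding S_def by (rule slit_disc_connected) fact
    have "0 < d" using r by (simp add: d_def add_pos_nonneg)
    thus "ball 0 d \<noteq> {}" by simp
    show "ball 0 d \<subseteq> S"
    proof
      fix x :: complex assume x: "x \<in> ball 0 d"
      have "1 - \<theta> * x \<notin> \<real>\<^sub>\<le>\<^sub>0"
        using small[OF x] complex_Re_le_cmod[of "\<theta> * x"]
        by (auto simp: complex_nonpos_Reals_iff simp del: times_complex.simps)
      thus "x \<in> S" using x by (simp add: S_def d_def)
    qed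
    have "eval_fps (hyp_fps a b c) holomorphic_on S"
      by (rule holomorphic_on_eval_fps) (use hyp in \<open>auto simp: S_def\<close>)
    hence "gauss_F a b c holomorphic_on S"
      by (simp add: eval_hyp_fps[abs_def])
    thus "calG a b c p \<theta> holomorphic_on S"
      unfolding calG_def[abs_def] by (intro holomorphic_intros) (auto simp: S_def)
    show "eval_fps (calG_fps a b c p \<theta>) holomorphic_on S"
    proof (rule holomorphic_on_eval_fps, rule subsetI)
      fix x assume "x \<in> S"
      hence "ereal (norm x) < ereal r" by (simp add: S_def)
      also note r(3)
      finally show "x \<in> eball 0 (fps_conv_radius (calG_fps a b c p \<theta>))" by simp
    qed
    show "calG a b c p \<theta> x = eval_fps (calG_fps a b c p \<theta>) x" if x: "x \<in> ball 0 d" for x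
      unfolding calG_fps_def calG_def
      using x small[OF x] hyp[of x] binom_fps_conv_radius[of \<theta> x p]
      by (subst eval_fps_mult) (simp_all add: eval_binom_fps eval_hyp_fps d_def)
  qed (use w in \<open>auto simp: S_def\<close>)
qed

theorem theorem3p1:
  fixes a b c p \<theta> z :: complex
  assumes "- c \<notin> \<nat>"
    and "norm z < 1"
    and "1 - \<theta> * z \<noteq> 0"
    and "\<bar>Arg (1 - \<theta> * z)\<bar> < pi"
  shows "(norm (\<theta> * z) < 1 \<or> p \<in> \<nat> \<longrightarrow> summable (\<lambda>n. vcoef a b c p \<theta> n * z ^ n)) \<and>
         (summable (\<lambda>n. vcoef a b c p \<theta> n * z ^ n) \<longrightarrow>
            calG a b c p \<theta> z = (\<Sum>n. vcoef a b c p \<theta> n * z ^ n))"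
proof (intro conjI impI)
  let ?V = "calG_fps a b c p \<theta>"
  let ?F = "hyp_fps a b c"
  have V: "vcoef a b c p \<theta> n = ?V $ n" for n
    by (simp add: calG_fps_nth[OF assms(1)])
  have F: "norm z < fps_conv_radius ?F"
  proof -
    have "ereal (norm z) < 1" using assms(2) by simp
    also have "\<dots> \<le> fps_conv_radius ?F" by (rule hyp_fps_conv_radius[OF assms(1)])
    finally show ?thesis .
  qed
  {
    assume "norm (\<theta> * z) < 1 \<or> p \<in> \<nat>"
    hence "norm z < min (fps_conv_radius (binom_fps p \<theta>)) (fps_conv_radius ?F)"
      using binom_fps_conv_radius F by simp
    also have "\<dots> \<le> fps_conv_radius ?V"
      unfolding calG_fps_def by (rule fps_conv_radius_mult)
    finally show "summable (\<lambda>n. vcoef a b c p \<theta> n * z ^ n)"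
      unfolding V by (rule summable_fps)
  }
  assume summable: "summable (\<lambda>n. vcoef a b c p \<theta> n * z ^ n)"
  show "calG a b c p \<theta> z = (\<Sum>n. vcoef a b c p \<theta> n * z ^ n)"
    \<comment> \<open>For \<open>z = 0\<close> the disc \<open>\<bar>w\<bar> < \<bar>z\<bar>\<close> is empty and only the constant terms matter.\<close>
  proof (cases "z = 0")
    case True
    thus ?thesis by (simp add: calG_def flip: eval_hyp_fps) (simp add: eval_fps_at_0 hyp_fps_def)
  next
    case False
    have slit: "1 - \<theta> * z \<notin> \<real>\<^sub>\<le>\<^sub>0"
      using assms(3,4) Arg_eq_pi[of "1 - \<theta> * z"]
      by (auto simp: complex_nonpos_Reals_iff complex_eq_iff)
    have radius: "norm z \<le> fps_conv_radius ?V"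
      unfolding fps_conv_radius_def using summable V by (intro conv_radius_geI) simp
    \<comment> \<open>Both sides are compared along the segment towards \<open>z\<close>, which avoids the slit.\<close>
    let ?ray = "\<lambda>t. of_real t * z"
    have lim_V: "((\<lambda>t. eval_fps ?V (?ray t)) \<longlongrightarrow> (\<Sum>n. vcoef a b c p \<theta> n * z ^ n)) (at_left 1)"
      using Abel_radial_limit[OF summable]
      by (simp add: V eval_fps_def scaleR_conv_of_real power_mult_distrib mult_ac)
    have "((\<lambda>t. (1 - \<theta> * ?ray t) powr p * eval_fps ?F (?ray t)) \<longlongrightarrow>
        (1 - \<theta> * ?ray 1) powr p * eval_fps ?F (?ray 1)) (at_left 1)"
    proof (intro tendsto_intros)
      have "isCont (eval_fps ?F) (?ray 1)"
        using F by (intro continuous_eval_fps) simp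
      thus "((\<lambda>t. eval_fps ?F (?ray t)) \<longlongrightarrow> eval_fps ?F (?ray 1)) (at_left 1)"
        by (rule isCont_tendsto_compose) (intro tendsto_intros)
    qed (use slit in auto)
    hence lim_G: "((\<lambda>t. calG a b c p \<theta> (?ray t)) \<longlongrightarrow> calG a b c p \<theta> z) (at_left 1)"
      by (simp add: calG_def eval_hyp_fps)
    have eq: "\<forall>\<^sub>F t in at_left 1. calG a b c p \<theta> (?ray t) = eval_fps ?V (?ray t)"
    proof (rule eventually_at_leftI)
      fix t :: real assume t: "t \<in> {0<..<1}"
      show "calG a b c p \<theta> (?ray t) = eval_fps ?V (?ray t)"
      proof (rule calG_eq_eval_on_slit_disc[OF assms(1) _ _ radius])
        show "norm (?ray t) < norm z" using t False by (simp add: norm_mult)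
        show "1 - \<theta> * ?ray t \<notin> \<real>\<^sub>\<le>\<^sub>0"
          using slit_plane_scaleR[OF slit, of t] t by (simp add: mult.left_commute)
      qed (use False assms(2) in auto)
    qed simp
    show ?thesis
      by (rule tendsto_unique[OF trivial_limit_at_left_real Lim_transform_eventually[OF lim_G eq] lim_V])
  qed
qed

end
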